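(* Let $n\ge 1$ and let $u:\mathbb{R}^n\to\mathbb{R}$ be a non-constant classical solution of $-\Delta u=u-u^3$ in $\mathbb{R}^n$. Write $\{u=0\}=\{x\in\mathbb{R}^n:u(x)=0\}$. If there exists a closed half-space $E\subset\mathbb{R}^n$ such that $\{u=0\}\subset E$ and $\{u=0\}\cap\partial E\neq\emptyset$, then there are $a\in\mathbb{R}$ and a unit vector $e$ orthogonal to $\partial E$ such that $u(x)=H(x\cdot e+a)$ for all $x\in\mathbb{R}^n$, where $H(t)=\tanh(t/\sqrt{2})$.
   Context: Solutions are real-valued and understood in the classical ($C^2$) sense on all of $\mathbb{R}^n$. *)

theory Defs
  imports "HOL-Analysis.Analysis"
begin

definition partial :: "'n::finite \<Rightarrow> (real ^ 'n \<Rightarrow> real) \<Rightarrow> real ^ 'n \<Rightarrow> real"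
  where "partial i f x = frechet_derivative f (at x) (axis i 1)"

definition C1 :: "(real ^ 'n::finite \<Rightarrow> real) \<Rightarrow> bool"
  where "C1 f \<longleftrightarrow> (\<forall>x. f differentiable (at x)) \<and> (\<forall>i. continuous_on UNIV (partial i f))"

definition C2 :: "(real ^ 'n::finite \<Rightarrow> real) \<Rightarrow> bool"
  where "C2 f \<longleftrightarrow> C1 f \<and> (\<forall>i. C1 (partial i f))"

definition laplacian :: "(real ^ 'n::finite \<Rightarrow> real) \<Rightarrow> real ^ 'n \<Rightarrow> real"
  where "laplacian f x = (\<Sum>i\<in>UNIV. partial i (partial i f) x)"

definition classical_allen_cahn_solution :: "(real ^ 'n::finite \<Rightarrow> real) \<Rightarrow> bool"
  where "classical_allen_cahn_solution u \<longleftrightarrow> C2 u \<and> (\<forall>x. - laplacian u x = u x - u x ^ 3)"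

definition is_closed_halfspace :: "(real ^ 'n::finite) set \<Rightarrow> bool"
  where "is_closed_halfspace E \<longleftrightarrow> (\<exists>v b. v \<noteq> 0 \<and> E = {x. v \<bullet> x \<le> b})"

text \<open>Orthogonality to an affine set means orthogonality to all its directions, that is,
  to all differences of its points. If the set is a single point (the boundary of a
  half-line in dimension one) the condition is vacuous.\<close>

definition orthogonal_to_affine :: "real ^ 'n::finite \<Rightarrow> (real ^ 'n) set \<Rightarrow> bool"
  where "orthogonal_to_affine e P \<longleftrightarrow> (\<forall>x\<in>P. \<forall>y\<in>P. orthogonal e (x - y))"

definition H :: "real \<Rightarrow> real"
  where "H t = tanh (t / sqrt 2)"

end

theory Submission
  imports Defs
begin

text \<open>Say \<open>u > 0\<close> off \<open>E = {x. x \<bullet> e \<le> b}\<close>; otherwise pass to \<open>- u\<close>. A Keller-Osserman barrier gives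
  \<open>\<bar>u\<bar> \<le> 1\<close>. Sliding a compactly supported subsolution inside the half-space bounds \<open>u\<close> from below by a positive
  constant on \<open>{x. x \<bullet> e \<ge> b + t}\<close>, and comparison there with \<open>H (x \<bullet> e - b - t)\<close>, \<open>t \<rightarrow> 0\<close>, yields
  \<open>u x \<ge> H (x \<bullet> e - b)\<close> off \<open>E\<close>. On \<open>E\<close> the same inequality follows by comparing \<open>- u\<close>, which is
  nonpositive on the boundary, with \<open>H (b - x \<bullet> e + t)\<close>. Equality holds at the zero of \<open>u\<close> on the boundary of
  \<open>E\<close>, so the strong maximum principle gives equality everywhere. The strictness needed in the unbounded
  comparisons comes from scaling the supersolution, so no compactness of translates is used.\<close>

section \<open>The pointwise Laplacian and its values on planar and radial functions\<close>

text \<open>Only second derivatives along the coordinate axes enter, and only near \<open>x\<close>, so that barriers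
  with singularities elsewhere are covered.\<close>

definition has_laplacian :: "(real ^ 'n::finite \<Rightarrow> real) \<Rightarrow> real \<Rightarrow> real ^ 'n \<Rightarrow> bool"
  where "has_laplacian f L x \<longleftrightarrow> (\<exists>D d. (\<forall>i.
           (\<forall>\<^sub>F s in nhds 0. ((\<lambda>s. f (x + s *\<^sub>R axis i 1)) has_real_derivative D i s) (at s)) \<and>
           (D i has_real_derivative d i) (at 0)) \<and> L = (\<Sum>i\<in>UNIV. d i))"

lemma has_laplacianI:
  assumes "\<And>i. \<forall>\<^sub>F s in nhds 0. ((\<lambda>s. f (x + s *\<^sub>R axis i 1)) has_real_derivative D i s) (at s)"
    and "\<And>i. (D i has_real_derivative d i) (at 0)" and "L = (\<Sum>i\<in>UNIV. d i)"
  shows "has_laplacian f L x"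
  unfolding has_laplacian_def using assms by (intro exI conjI allI)

lemma has_laplacianE:
  assumes "has_laplacian f L x"
  obtains D d where
    "\<And>i. \<forall>\<^sub>F s in nhds 0. ((\<lambda>s. f (x + s *\<^sub>R axis i 1)) has_real_derivative D i s) (at s)"
    "\<And>i. (D i has_real_derivative d i) (at 0)" "L = (\<Sum>i\<in>UNIV. d i)"
  using assms unfolding has_laplacian_def by (elim exE conjE) (rule that, auto)

lemma has_laplacian_diff:
  assumes "has_laplacian f L x" and "has_laplacian g M x"
  shows "has_laplacian (\<lambda>y. f y - g y) (L - M) x"
proof -
  obtain D d where
    f: "\<And>i. \<forall>\<^sub>F s in nhds 0. ((\<lambda>s. f (x + s *\<^sub>R axis i 1)) has_real_derivative D i s) (at s)"
       "\<And>i. (D i has_real_derivative d i) (at 0)" "L = (\<Sum>i\<in>UNIV. d i)"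
    using has_laplacianE[OF assms(1)] by blast
  obtain D' d' where
    g: "\<And>i. \<forall>\<^sub>F s in nhds 0. ((\<lambda>s. g (x + s *\<^sub>R axis i 1)) has_real_derivative D' i s) (at s)"
       "\<And>i. (D' i has_real_derivative d' i) (at 0)" "M = (\<Sum>i\<in>UNIV. d' i)"
    using has_laplacianE[OF assms(2)] by blast
  have "\<forall>\<^sub>F s in nhds 0. ((\<lambda>s. f (x + s *\<^sub>R axis i 1) - g (x + s *\<^sub>R axis i 1))
          has_real_derivative D i s - D' i s) (at s)" for i
    using f(1)[of i] g(1)[of i] by eventually_elim (rule DERIV_diff)
  moreover have "((\<lambda>s. D i s - D' i s) has_real_derivative d i - d' i) (at 0)" for i
    by (intro DERIV_diff f g)
  moreover have "L - M = (\<Sum>i\<in>UNIV. d i - d' i)"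
    by (simp add: f(3) g(3) sum_subtractf)
  ultimately show ?thesis by (rule has_laplacianI)
qed

lemma has_laplacian_cmult:
  assumes "has_laplacian f L x"
  shows "has_laplacian (\<lambda>y. c * f y) (c * L) x"
proof -
  obtain D d where
    f: "\<And>i. \<forall>\<^sub>F s in nhds 0. ((\<lambda>s. f (x + s *\<^sub>R axis i 1)) has_real_derivative D i s) (at s)"
       "\<And>i. (D i has_real_derivative d i) (at 0)" "L = (\<Sum>i\<in>UNIV. d i)"
    using has_laplacianE[OF assms] by blast
  have "\<forall>\<^sub>F s in nhds 0. ((\<lambda>s. c * f (x + s *\<^sub>R axis i 1)) has_real_derivative c * D i s) (at s)" for i
    using f(1)[of i] by eventually_elim (rule DERIV_cmult)
  moreover have "((\<lambda>s. c * D i s) has_real_derivative c * d i) (at 0)" for i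
    by (intro DERIV_cmult f)
  moreover have "c * L = (\<Sum>i\<in>UNIV. c * d i)"
    by (simp add: f(3) sum_distrib_left)
  ultimately show ?thesis by (rule has_laplacianI)
qed

lemma has_laplacian_minus:
  "has_laplacian f L x \<Longrightarrow> has_laplacian (\<lambda>y. - f y) (- L) x"
  using has_laplacian_cmult[of f L x "-1"] by simp

lemma partial_has_real_derivative:
  assumes "f differentiable (at (x + s *\<^sub>R axis i 1))"
  shows "((\<lambda>s. f (x + s *\<^sub>R axis i 1)) has_real_derivative partial i f (x + s *\<^sub>R axis i 1)) (at s)"
proof -
  let ?y = "x + s *\<^sub>R axis i 1"
  have line: "((\<lambda>s. x + s *\<^sub>R axis i 1) has_derivative (\<lambda>h. h *\<^sub>R axis i 1)) (at s)"
    using has_derivative_add[OF has_derivative_const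
            has_derivative_scaleR_left[OF has_derivative_ident], of x "axis i 1" "at s"]
    by simp
  have "(f has_derivative frechet_derivative f (at ?y)) (at ?y)"
    using assms unfolding frechet_derivative_works .
  note compose = has_derivative_compose[OF line this]
  have eq: "frechet_derivative f (at ?y) (h *\<^sub>R axis i 1) = partial i f ?y * h" for h
    using linear_cmul[OF linear_frechet_derivative[OF assms], of h "axis i 1"]
    unfolding partial_def real_scaleR_def by (simp only: mult.commute)
  show ?thesis
    using compose unfolding has_field_derivative_def eq .
qed

text \<open>The later estimates use a solution only through its continuity and this fact.\<close>

lemma C2_has_laplacian:
  assumes "C2 f"
  shows "has_laplacian f (laplacian f x) x"
proof -
  have d1: "f differentiable (at y)" and d2: "partial i f differentiable (at y)" for y i
    using assms by (auto simp: C2_def C1_def)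
  show ?thesis
  proof (rule has_laplacianI)
    show "\<forall>\<^sub>F s in nhds 0. ((\<lambda>s. f (x + s *\<^sub>R axis i 1)) has_real_derivative
            partial i f (x + s *\<^sub>R axis i 1)) (at s)" for i
      by (intro always_eventually allI partial_has_real_derivative d1)
    show "((\<lambda>s. partial i f (x + s *\<^sub>R axis i 1)) has_real_derivative partial i (partial i f) x) (at 0)" for i
      using partial_has_real_derivative[of "partial i f" x 0 i] d2 by simp
  qed (simp add: laplacian_def)
qed

text \<open>Along the axis \<open>i\<close> the argument moves with speed \<open>e $ i\<close>, so
  the second derivative is \<open>c * (e $ i)^2\<close>; these sum to \<open>c\<close> because
  \<open>e\<close> is a unit vector.\<close>

lemma has_laplacian_planar:
  fixes e :: "real ^ 'n::finite"
  assumes "\<And>t. (\<phi> has_real_derivative \<phi>' t) (at t)"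
    and "(\<phi>' has_real_derivative c) (at (x \<bullet> e + a))" and "norm e = 1"
  shows "has_laplacian (\<lambda>y. \<phi> (y \<bullet> e + a)) c x"
proof -
  have line: "(x + s *\<^sub>R axis i 1) \<bullet> e + a = x \<bullet> e + a + s * e $ i" for s and i :: 'n
    by (simp add: inner_left_distrib inner_axis')
  have affine: "((\<lambda>s. x \<bullet> e + a + s * e $ i) has_real_derivative e $ i) (at s)" for s i
    by (auto intro!: derivative_eq_intros)
  have "((\<lambda>s. \<phi> (x \<bullet> e + a + s * e $ i)) has_real_derivative \<phi>' (x \<bullet> e + a + s * e $ i) * e $ i) (at s)" for s i
    by (rule DERIV_chain2[OF assms(1) affine])
  moreover have "((\<lambda>s. \<phi>' (x \<bullet> e + a + s * e $ i) * e $ i) has_real_derivative (c * e $ i) * e $ i) (at 0)" for i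
  proof -
    have "(\<phi>' has_real_derivative c) (at (x \<bullet> e + a + 0 * e $ i))" using assms(2) by simp
    from DERIV_cmult_right[OF DERIV_chain2[OF this affine[of i 0]]] show ?thesis .
  qed
  moreover have "c = (\<Sum>i\<in>UNIV. (c * e $ i) * e $ i)"
  proof -
    have "(\<Sum>i\<in>UNIV. (c * e $ i) * e $ i) = c * (e \<bullet> e)"
      by (simp add: inner_vec_def sum_distrib_left mult.assoc)
    then show ?thesis using assms(3) by (simp add: dot_square_norm)
  qed
  ultimately show ?thesis
    by (intro has_laplacianI[where D = "\<lambda>i s. \<phi>' (x \<bullet> e + a + s * e $ i) * e $ i"]
          always_eventually allI) (simp_all only: line)
qed

text \<open>Writing the profile in \<open>t = |y - p|^2\<close> keeps it smooth at \<open>p\<close>: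
  along an axis \<open>t\<close> is a quadratic polynomial, and the chain rule gives
  \<open>4 c z_i^2 + 2 \<phi>'\<close>. Differentiability of \<open>\<phi>\<close> is asked only
  near one value, which admits profiles that blow up elsewhere.\<close>

lemma has_laplacian_radial:
  fixes p :: "real ^ 'n::finite"
  assumes "\<forall>\<^sub>F t in nhds ((norm (x - p))\<^sup>2). (\<phi> has_real_derivative \<phi>' t) (at t)"
    and "(\<phi>' has_real_derivative c) (at ((norm (x - p))\<^sup>2))"
  shows "has_laplacian (\<lambda>y. \<phi> ((norm (y - p))\<^sup>2))
           (4 * (norm (x - p))\<^sup>2 * c + 2 * real CARD('n) * \<phi>' ((norm (x - p))\<^sup>2)) x"
proof -
  define q where "q = (norm (x - p))\<^sup>2"
  define z where "z = x - p"
  have line: "(norm (x + s *\<^sub>R axis i 1 - p))\<^sup>2 = q + 2 * s * z $ i + s\<^sup>2" for s and i :: 'n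
  proof -
    have "x + s *\<^sub>R axis i 1 - p = z + s *\<^sub>R axis i 1" by (simp add: z_def)
    then show ?thesis
      unfolding power2_norm_eq_inner q_def
      by (simp only:) (simp add: z_def[symmetric] inner_left_distrib inner_right_distrib inner_axis inner_axis'
            power2_eq_square distrib_left)
  qed
  have quad: "((\<lambda>s. q + 2 * s * z $ i + s\<^sup>2) has_real_derivative 2 * (z $ i + s)) (at s)" for s i
    by (rule derivative_eq_intros refl)+ simp
  have affine: "((\<lambda>s. 2 * (z $ i + s)) has_real_derivative 2) (at s)" for s i
    by (rule derivative_eq_intros refl)+ simp
  have "\<forall>\<^sub>F s in nhds 0. ((\<lambda>s. \<phi> (q + 2 * s * z $ i + s\<^sup>2)) has_real_derivative
          \<phi>' (q + 2 * s * z $ i + s\<^sup>2) * (2 * (z $ i + s))) (at s)" for i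
  proof -
    have "((\<lambda>s. q + 2 * s * z $ i + s\<^sup>2) \<longlongrightarrow> q + 2 * 0 * z $ i + 0\<^sup>2) (nhds 0)"
      by (intro tendsto_intros filterlim_ident)
    then have "filterlim (\<lambda>s. q + 2 * s * z $ i + s\<^sup>2) (nhds q) (nhds 0)" by simp
    from eventually_compose_filterlim[OF assms(1)[folded q_def] this]
    show ?thesis by eventually_elim (rule DERIV_chain2[OF _ quad])
  qed
  moreover have "((\<lambda>s. \<phi>' (q + 2 * s * z $ i + s\<^sup>2) * (2 * (z $ i + s))) has_real_derivative
      4 * c * (z $ i)\<^sup>2 + 2 * \<phi>' q) (at 0)" for i
  proof -
    have c: "(\<phi>' has_real_derivative c) (at (q + 2 * 0 * z $ i + 0\<^sup>2))"
      using assms(2) by (simp add: q_def)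
    show ?thesis
      using DERIV_mult[OF DERIV_chain2[OF c quad] affine[of i 0]]
      by (simp add: power2_eq_square algebra_simps)
  qed
  moreover have "4 * q * c + 2 * real CARD('n) * \<phi>' q = (\<Sum>i\<in>UNIV. 4 * c * (z $ i)\<^sup>2 + 2 * \<phi>' q)"
  proof -
    have "q = (\<Sum>i\<in>UNIV. (z $ i)\<^sup>2)"
      unfolding q_def z_def[symmetric] power2_norm_eq_inner by (simp add: inner_vec_def power2_eq_square)
    then have "4 * q * c = (\<Sum>i\<in>UNIV. 4 * c * (z $ i)\<^sup>2)"
      by (simp only: sum_distrib_left[symmetric]) simp
    then show ?thesis by (simp add: sum.distrib)
  qed
  ultimately show ?thesis
    unfolding q_def[symmetric] line[symmetric] by (rule has_laplacianI)
qed

section \<open>Maximum principles at interior points and on unbounded sets\<close>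

lemma second_derivative_local_max:
  fixes g D :: "real \<Rightarrow> real"
  assumes deriv: "\<forall>\<^sub>F s in nhds 0. (g has_real_derivative D s) (at s)"
    and "(D has_real_derivative d) (at 0)" and max: "\<forall>\<^sub>F s in nhds 0. g s \<le> g 0"
  shows "d \<le> 0"
proof (rule ccontr)
  assume "\<not> d \<le> 0"
  then have "d > 0" by simp
  from deriv obtain r where r: "r > 0" "\<And>s. \<bar>s\<bar> < r \<Longrightarrow> (g has_real_derivative D s) (at s)"
    unfolding eventually_nhds_metric by (auto simp: dist_real_def)
  from max obtain r' where r': "r' > 0" "\<And>s. \<bar>s\<bar> < r' \<Longrightarrow> g s \<le> g 0"
    unfolding eventually_nhds_metric by (auto simp: dist_real_def)
  have "D 0 = 0"
    by (rule DERIV_local_max[of g "D 0" 0 r']) (use r r' in auto)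
  with DERIV_pos_inc_right[OF assms(2) \<open>d > 0\<close>] obtain k where
    k: "k > 0" "\<And>h. 0 < h \<Longrightarrow> h < k \<Longrightarrow> D h > 0" by auto
  \<comment> \<open>Just to the right of \<open>0\<close> the derivative \<open>D\<close> is
    positive, so \<open>g\<close> increases strictly there, against the maximum.\<close>
  define s where "s = min (min r r') k / 2"
  have s: "0 < s" "s < r" "s < r'" "s < k" using r(1) r'(1) k(1) by (auto simp: s_def)
  have "g 0 < g s"
  proof (rule DERIV_pos_imp_increasing_open[OF s(1)])
    show "\<exists>y. (g has_real_derivative y) (at t) \<and> 0 < y" if "0 < t" "t < s" for t
      using that s k(2)[of t] r(2)[of t] by auto
    show "continuous_on {0..s} g"
      by (rule DERIV_continuous_on[where D = D])
         (use s r(2) in \<open>auto intro: has_field_derivative_at_within\<close>)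
  qed
  with r'(2)[of s] s show False by simp
qed

text \<open>The one-variable test applies along each axis, as a short segment through an interior
  point stays in \<open>S\<close>.\<close>

lemma has_laplacian_max:
  assumes "has_laplacian f L x" and "x \<in> interior S" and "\<And>y. y \<in> S \<Longrightarrow> f y \<le> f x"
  shows "L \<le> 0"
proof -
  obtain D d where
    f: "\<And>i. \<forall>\<^sub>F s in nhds 0. ((\<lambda>s. f (x + s *\<^sub>R axis i 1)) has_real_derivative D i s) (at s)"
       "\<And>i. (D i has_real_derivative d i) (at 0)" "L = (\<Sum>i\<in>UNIV. d i)"
    using has_laplacianE[OF assms(1)] by blast
  have "d i \<le> 0" for i
  proof (rule second_derivative_local_max[OF f(1,2)])
    have "((\<lambda>s. x + s *\<^sub>R axis i 1) \<longlongrightarrow> x + 0 *\<^sub>R axis i 1) (nhds 0)"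
      by (intro tendsto_intros filterlim_ident)
    from topological_tendstoD[OF this open_interior[of S]] assms(2)
    have "\<forall>\<^sub>F s in nhds 0. x + s *\<^sub>R axis i 1 \<in> interior S" by simp
    then show "\<forall>\<^sub>F s in nhds 0. f (x + s *\<^sub>R axis i 1) \<le> f (x + 0 *\<^sub>R axis i 1)"
      by eventually_elim (use assms(3) interior_subset in force)
  qed
  then show ?thesis unfolding f(3) by (rule sum_nonpos)
qed

text \<open>On an unbounded set the supremum may not be attained. Subtracting the penalty
  \<open>c |y - p|^2\<close> forces a maximum, at a cost of \<open>\<epsilon>\<close> in the
  Laplacian and without dropping below \<open>w p\<close>.\<close>

lemma approximate_maximum_principle:
  fixes w :: "real ^ 'n::finite \<Rightarrow> real"
  assumes "closed S" and "continuous_on S w" and "\<And>y. y \<in> S \<Longrightarrow> w y \<le> B"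
    and "p \<in> S" and "\<epsilon> > 0"
  obtains x where "x \<in> S" and "w p \<le> w x"
    and "\<And>L. x \<in> interior S \<Longrightarrow> has_laplacian w L x \<Longrightarrow> L \<le> \<epsilon>"
proof -
  \<comment> \<open>The penalty has Laplacian \<open>2 n c\<close> in dimension \<open>n\<close>,
    which this choice makes equal to \<open>\<epsilon>\<close>.\<close>
  define c where "c = \<epsilon> / (2 * real CARD('n))"
  have "c > 0" using assms(5) by (simp add: c_def)
  define f where "f = (\<lambda>y. w y - c * (norm (y - p))\<^sup>2)"
  \<comment> \<open>Beyond radius \<open>r\<close> the penalty is at least \<open>B - w p\<close>,
    so \<open>f \<le> w p = f p\<close> there and a maximum over the compact part of
    \<open>S\<close> is global.\<close>
  define r where "r = sqrt ((B - w p) / c)"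
  have Bp: "w p \<le> B" using assms(3,4) by simp
  then have r: "r \<ge> 0" "c * r\<^sup>2 = B - w p" using \<open>c > 0\<close> by (auto simp: r_def)
  have "compact (S \<inter> cball p r)" using assms(1) by (simp add: closed_Int_compact)
  moreover have "S \<inter> cball p r \<noteq> {}" using assms(4) r by auto
  moreover have "continuous_on (S \<inter> cball p r) f"
    unfolding f_def by (intro continuous_intros continuous_on_subset[OF assms(2)]) auto
  ultimately obtain x where x: "x \<in> S \<inter> cball p r" "\<And>y. y \<in> S \<inter> cball p r \<Longrightarrow> f y \<le> f x"
    using continuous_attains_sup by metis
  have fp: "w p \<le> f x" using x(2)[of p] assms(4) r by (simp add: f_def)
  have max: "f y \<le> f x" if "y \<in> S" for y
  proof (cases "y \<in> cball p r")
    case False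
    then have "r\<^sup>2 \<le> (norm (y - p))\<^sup>2" using r(1) by (simp add: dist_norm norm_minus_commute power_mono)
    then have "c * r\<^sup>2 \<le> c * (norm (y - p))\<^sup>2" using \<open>c > 0\<close> by simp
    with assms(3)[OF that] r(2) fp show ?thesis by (simp add: f_def)
  qed (use that x in auto)
  show thesis
  proof
    show "x \<in> S" using x by simp
    show "w p \<le> w x" using fp \<open>c > 0\<close> unfolding f_def by (smt (verit) zero_le_power2 mult_nonneg_nonneg)
    show "L \<le> \<epsilon>" if "x \<in> interior S" "has_laplacian w L x" for L
    proof -
      have "has_laplacian (\<lambda>y. c * (norm (y - p))\<^sup>2)
              (4 * (norm (x - p))\<^sup>2 * 0 + 2 * real CARD('n) * c) x"
        by (rule has_laplacian_radial[where \<phi> = "\<lambda>t. c * t" and \<phi>' = "\<lambda>_. c"])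
           (auto intro!: always_eventually derivative_eq_intros)
      from has_laplacian_diff[OF that(2) this]
      have "has_laplacian f (L - \<epsilon>) x" by (simp add: f_def c_def)
      from has_laplacian_max[OF this that(1) max] show ?thesis by simp
    qed
  qed
qed

section \<open>Comparison of sub- and supersolutions on closed sets\<close>

text \<open>With \<open>M = sup (f / g)\<close>, assumed to exceed \<open>1\<close>, the function \<open>f - M g\<close> is nonpositive and
  comes arbitrarily close to \<open>0\<close>. Scaling the supersolution \<open>g\<close> by \<open>M > 1\<close> gains
  the term \<open>(M\<^sup>3 - M) g\<^sup>3 \<ge> (M\<^sup>3 - M) \<delta>\<^sup>3\<close>, which contradicts the approximate maximum principle.\<close>

lemma allen_cahn_comparison:
  fixes f g :: "real ^ 'n::finite \<Rightarrow> real"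
  assumes "closed S" and cont: "continuous_on S f" "continuous_on S g"
    and f_le: "\<And>x. x \<in> S \<Longrightarrow> f x \<le> 1" and f_frontier: "\<And>x. x \<in> frontier S \<Longrightarrow> f x \<le> 0"
    and "\<delta> > 0" and g_ge: "\<And>x. x \<in> S \<Longrightarrow> \<delta> \<le> g x"
    and sub: "\<And>x. x \<in> interior S \<Longrightarrow> \<exists>L. has_laplacian f L x \<and> f x ^ 3 - f x \<le> L"
    and super: "\<And>x. x \<in> interior S \<Longrightarrow> \<exists>L. has_laplacian g L x \<and> L \<le> g x ^ 3 - g x"
    and "z \<in> S"
  shows "f z \<le> g z"
proof (rule ccontr)
  assume "\<not> f z \<le> g z"
  define M where "M = (SUP y\<in>S. f y / g y)"
  have g_pos: "0 < g y" if "y \<in> S" for y using g_ge[OF that] assms(6) by simp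
  have "f y / g y \<le> 1 / \<delta>" if "y \<in> S" for y
    using f_le[OF that] g_ge[OF that] assms(6) by (intro frac_le) auto
  then have bdd: "bdd_above ((\<lambda>y. f y / g y) ` S)" by (intro bdd_aboveI2)
  have le_M: "f y / g y \<le> M" if "y \<in> S" for y
    unfolding M_def using that bdd by (rule cSUP_upper)
  have "1 < f z / g z" using \<open>\<not> f z \<le> g z\<close> g_pos[OF assms(10)] by (simp add: field_simps)
  with le_M[OF assms(10)] have "M > 1" by linarith
  define \<kappa> where "\<kappa> = (M ^ 3 - M) * \<delta> ^ 3"
  have M3: "M ^ 3 - M > 0"
  proof -
    have "M ^ 3 - M = M * (M - 1) * (M + 1)" by (simp add: power3_eq_cube algebra_simps)
    then show ?thesis using \<open>M > 1\<close> by simp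
  qed
  with assms(6) have "\<kappa> > 0" by (simp add: \<kappa>_def)
  \<comment> \<open>The three bounds serve in turn to keep \<open>x\<close> off the frontier, to
    confine \<open>f x\<close> and \<open>M * g x\<close> to a bounded range, and to make the error
    \<open>7 * \<eta>\<close> smaller than \<open>\<kappa> / 2\<close>.\<close>
  define \<eta> where "\<eta> = min (min (M * \<delta> / 2) 1) (\<kappa> / 16)"
  have \<eta>: "0 < \<eta>" "\<eta> < M * \<delta>" "\<eta> \<le> 1" "16 * \<eta> \<le> \<kappa>"
  proof -
    have "M * \<delta> > 0" using \<open>M > 1\<close> assms(6) by simp
    then show "0 < \<eta>" "\<eta> < M * \<delta>" "\<eta> \<le> 1" "16 * \<eta> \<le> \<kappa>"
      using \<open>\<kappa> > 0\<close> by (auto simp: \<eta>_def min_def)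
  qed
  \<comment> \<open>Having \<open>M - \<theta> \<ge> 1\<close> gives
    \<open>g p < f p \<le> 1\<close> at the near-maximiser \<open>p\<close>, so a ratio within
    \<open>\<theta>\<close> of \<open>M\<close> puts \<open>w p\<close> within \<open>\<eta>\<close>
    of \<open>0\<close>.\<close>
  define \<theta> where "\<theta> = min \<eta> (M - 1)"
  have \<theta>: "0 < \<theta>" "\<theta> \<le> \<eta>" "1 \<le> M - \<theta>" using \<eta> \<open>M > 1\<close> by (auto simp: \<theta>_def)
  have "S \<noteq> {}" using assms(10) by auto
  have "M - \<theta> < (SUP y\<in>S. f y / g y)" using \<theta> by (simp add: M_def)
  then obtain p where p: "p \<in> S" "M - \<theta> < f p / g p"
    unfolding less_cSUP_iff[OF \<open>S \<noteq> {}\<close> bdd] by blast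
  define w where "w = (\<lambda>y. f y - M * g y)"
  have w_le: "w y \<le> 0" if "y \<in> S" for y
    using le_M[OF that] g_pos[OF that] by (simp add: w_def field_simps)
  have wp: "- \<eta> < w p"
  proof -
    have "(M - \<theta>) * g p < f p" using p g_pos[OF p(1)] by (simp add: field_simps)
    moreover have "1 * g p \<le> (M - \<theta>) * g p"
      using \<theta>(3) g_pos[OF p(1)] by (intro mult_right_mono) auto
    ultimately have "g p < 1" and *: "- (\<theta> * g p) < w p"
      using f_le[OF p(1)] by (auto simp: w_def algebra_simps)
    then have "\<theta> * g p \<le> \<theta> * 1" using \<theta> by (intro mult_left_mono) auto
    with * \<theta>(2) show ?thesis by linarith
  qed
  have "continuous_on S w" unfolding w_def by (intro continuous_intros cont)
  from approximate_maximum_principle[OF assms(1) this w_le p(1), of "\<kappa> / 2"] \<open>\<kappa> > 0\<close>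
  obtain x where x: "x \<in> S" "w p \<le> w x"
    and lap: "\<And>L. x \<in> interior S \<Longrightarrow> has_laplacian w L x \<Longrightarrow> L \<le> \<kappa> / 2" by auto
  have wx: "- \<eta> < w x" using wp x(2) by simp
  have "x \<in> interior S"
  proof (rule ccontr)
    assume "x \<notin> interior S"
    with x(1) have "x \<in> frontier S" by (simp add: frontier_def closure_closed assms(1))
    then have "f x \<le> 0" by (rule f_frontier)
    moreover have "M * \<delta> \<le> M * g x" using g_ge[OF x(1)] \<open>M > 1\<close> by simp
    ultimately show False using wx \<eta>(2) by (simp add: w_def)
  qed
  from sub[OF this] super[OF this] obtain L L' where
    L: "has_laplacian f L x" "f x ^ 3 - f x \<le> L" and
    L': "has_laplacian g L' x" "L' \<le> g x ^ 3 - g x" by blast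
  have "has_laplacian w (L - M * L') x"
    unfolding w_def by (intro has_laplacian_diff has_laplacian_cmult L L')
  from lap[OF \<open>x \<in> interior S\<close> this] have "L - M * L' \<le> \<kappa> / 2" .
  moreover have "M * L' \<le> M * (g x ^ 3 - g x)" using L'(2) \<open>M > 1\<close> by simp
  ultimately have upper: "f x ^ 3 - f x - M * (g x ^ 3 - g x) \<le> \<kappa> / 2" using L(2) by linarith
  \<comment> \<open>Since \<open>a^3 - a - (b^3 - b) = (a - b) * c\<close> and \<open>a - b\<close>
    lies in \<open>(-\<eta>, 0]\<close>, an upper bound on \<open>c\<close> limits the loss; scaling
    by \<open>M\<close> gains at least \<open>\<kappa>\<close>.\<close>
  define a b where "a = f x" and "b = M * g x"
  define c where "c = a\<^sup>2 + a * b + b\<^sup>2 - 1"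
  have w: "w x = a - b" by (simp add: w_def a_def b_def)
  have "b > 0" using g_pos[OF x(1)] \<open>M > 1\<close> by (simp add: b_def)
  have ab: "a \<le> 1" "-1 \<le> a" "b \<le> 2" using f_le[OF x(1)] wx \<eta>(3) \<open>b > 0\<close> w by (auto simp: a_def)
  have "c \<le> 7"
  proof -
    have "a\<^sup>2 \<le> 1" using ab by (simp add: abs_square_le_1 abs_le_iff)
    moreover have "a * b \<le> 1 * b" using ab \<open>b > 0\<close> by (intro mult_right_mono) auto
    moreover have "b\<^sup>2 \<le> 2\<^sup>2" using ab \<open>b > 0\<close> by (intro power_mono) auto
    ultimately show ?thesis using ab by (simp add: c_def)
  qed
  have "- (7 * \<eta>) \<le> w x * c"
  proof (cases "c \<le> 0")
    case True
    then have "0 \<le> w x * c" using w_le[OF x(1)] by (simp add: mult_nonpos_nonpos)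
    then show ?thesis using \<eta>(1) by linarith
  next
    case False
    then have "- \<eta> * c \<le> w x * c" using wx by (intro mult_right_mono) auto
    moreover have "\<eta> * c \<le> \<eta> * 7" using \<open>c \<le> 7\<close> \<eta>(1) by (intro mult_left_mono) auto
    ultimately show ?thesis by simp
  qed
  moreover have "\<kappa> \<le> (M ^ 3 - M) * g x ^ 3"
    unfolding \<kappa>_def using M3 g_ge[OF x(1)] assms(6) by (intro mult_left_mono power_mono) auto
  moreover have "f x ^ 3 - f x - M * (g x ^ 3 - g x) = w x * c + (M ^ 3 - M) * g x ^ 3"
    unfolding w c_def a_def b_def by (simp add: power3_eq_cube power2_eq_square algebra_simps)
  ultimately show False using upper \<eta>(4) \<open>\<kappa> > 0\<close> by linarith
qed

section \<open>A priori bounds from barriers on balls\<close>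

text \<open>The barrier \<open>1 + A / (R\<^sup>2 - |x - p|\<^sup>2)\<close> with \<open>A\<^sup>2 = (8 + 2 n) R\<^sup>2\<close> is a supersolution on the ball of radius
  \<open>R\<close> that blows up at the boundary, and its value \<open>1 + A / R\<^sup>2\<close> at \<open>p\<close> tends to \<open>1\<close> as \<open>R \<rightarrow> \<infinity>\<close>.\<close>

lemma allen_cahn_le_one:
  fixes u :: "real ^ 'n::finite \<Rightarrow> real"
  assumes "continuous_on UNIV u" and lap: "\<And>x. has_laplacian u (u x ^ 3 - u x) x"
  shows "u p \<le> 1"
proof (rule ccontr)
  assume "\<not> u p \<le> 1"
  then have up: "u p - 1 > 0" by simp
  define n where "n = real CARD('n)"
  define K where "K = sqrt (8 + 2 * n)"
  have n: "n > 0" by (simp add: n_def)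
  then have K: "K > 0" "K\<^sup>2 = 8 + 2 * n" by (auto simp: K_def)
  \<comment> \<open>With this radius the barrier at \<open>p\<close> equals
    \<open>1 + (u p - 1) / 2\<close>, halfway between \<open>1\<close> and
    \<open>u p\<close>.\<close>
  define R where "R = 2 * K / (u p - 1)"
  have R: "R > 0" using K up by (simp add: R_def)
  define A where "A = R * K"
  have A: "A > 0" "A\<^sup>2 = R\<^sup>2 * (8 + 2 * n)" using R K by (auto simp: A_def power_mult_distrib)
  have "continuous_on (cball p R) u" using assms(1) by (rule continuous_on_subset) simp
  from continuous_attains_sup[OF compact_cball _ this] R
  obtain m where m: "m \<in> cball p R" "\<And>y. y \<in> cball p R \<Longrightarrow> u y \<le> u m" by auto
  define B where "B = u m"
  have "u p \<le> B" unfolding B_def using R by (intro m(2)) simp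
  then have B: "B > 0" "\<And>y. y \<in> cball p R \<Longrightarrow> u y \<le> B" using m(2) up by (auto simp: B_def)
  \<comment> \<open>On the sphere \<open>|y - p|^2 = R^2 - h\<close> the barrier is
    \<open>1 + A / h > B\<close>, hence above \<open>u\<close>; the bound \<open>R^2 / 2\<close>
    keeps the radius of this sphere positive.\<close>
  define h where "h = min (R\<^sup>2 / 2) (A / B)"
  have h: "0 < h" "h < R\<^sup>2" "B \<le> A / h"
  proof -
    show "0 < h" using R A B by (simp add: h_def)
    have "R\<^sup>2 / 2 < R\<^sup>2" using R by simp
    moreover have "h \<le> R\<^sup>2 / 2" unfolding h_def by (rule min.cobounded1)
    ultimately show "h < R\<^sup>2" by linarith
    have "h \<le> A / B" unfolding h_def by (rule min.cobounded2)
    then show "B \<le> A / h" using \<open>0 < h\<close> B(1) by (simp add: field_simps)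
  qed
  define \<rho> where "\<rho> = sqrt (R\<^sup>2 - h)"
  have \<rho>: "\<rho> > 0" "\<rho>\<^sup>2 = R\<^sup>2 - h" "\<rho> < R"
  proof -
    show "\<rho> > 0" "\<rho>\<^sup>2 = R\<^sup>2 - h" using h by (auto simp: \<rho>_def)
    show "\<rho> < R" unfolding \<rho>_def using h R by (intro real_less_lsqrt) auto
  qed
  define \<phi> where "\<phi> = (\<lambda>t. 1 + A / (R\<^sup>2 - t))"
  define f where "f = (\<lambda>y. u y - \<phi> ((norm (y - p))\<^sup>2))"
  have pos: "R\<^sup>2 - (norm (y - p))\<^sup>2 > 0" if "y \<in> cball p \<rho>" for y
  proof -
    have "(norm (y - p))\<^sup>2 \<le> \<rho>\<^sup>2"
      using that by (intro power_mono) (auto simp: dist_norm norm_minus_commute)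
    then show ?thesis using \<rho>(2) h(1) by simp
  qed
  have "continuous_on (cball p \<rho>) f"
    unfolding f_def \<phi>_def using pos
    by (intro continuous_intros continuous_on_subset[OF assms(1)]) force+
  from continuous_attains_sup[OF compact_cball _ this] \<rho>
  obtain x where x: "x \<in> cball p \<rho>" "\<And>y. y \<in> cball p \<rho> \<Longrightarrow> f y \<le> f x" by auto
  have "f p > 0"
  proof -
    have "A / R\<^sup>2 = (u p - 1) / 2" using R K by (simp add: A_def power2_eq_square) (simp add: R_def)
    then show ?thesis using up by (simp add: f_def \<phi>_def)
  qed
  with x(2)[of p] \<rho> have fx: "f x > 0" by force
  define q s where "q = (norm (x - p))\<^sup>2" and "s = R\<^sup>2 - q"
  have s: "s > 0" "q \<ge> 0" using pos[OF x(1)] by (auto simp: s_def q_def)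
  have "x \<in> ball p \<rho>"
  proof (rule ccontr)
    assume "x \<notin> ball p \<rho>"
    with x(1) have "norm (x - p) = \<rho>" by (simp add: dist_norm norm_minus_commute)
    then have "f x = u x - 1 - A / h" by (simp add: f_def \<phi>_def \<rho>(2))
    moreover have "u x \<le> B" using x(1) \<rho>(3) by (intro B(2)) auto
    ultimately show False using fx h(3) by simp
  qed
  then have int: "x \<in> interior (cball p \<rho>)" by simp
  have "has_laplacian (\<lambda>y. \<phi> ((norm (y - p))\<^sup>2)) (4 * q * (2 * A / s ^ 3) + 2 * n * (A / s\<^sup>2)) x"
  proof -
    have "((\<lambda>t. A / (R\<^sup>2 - t)\<^sup>2) has_real_derivative 2 * A / s ^ 3) (at q)"
    proof -
      have "((\<lambda>t. (R\<^sup>2 - t)\<^sup>2) has_real_derivative - (2 * s)) (at q)"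
        unfolding s_def by (rule derivative_eq_intros refl)+ simp
      from DERIV_divide[OF DERIV_const[of A] this] s
      have "((\<lambda>t. A / (R\<^sup>2 - t)\<^sup>2) has_real_derivative
              (0 * (R\<^sup>2 - q)\<^sup>2 - A * - (2 * s)) / ((R\<^sup>2 - q)\<^sup>2 * (R\<^sup>2 - q)\<^sup>2)) (at q)"
        by (simp add: s_def del: mult_minus_right)
      moreover have "(0 * (R\<^sup>2 - q)\<^sup>2 - A * - (2 * s)) / ((R\<^sup>2 - q)\<^sup>2 * (R\<^sup>2 - q)\<^sup>2) = 2 * A / s ^ 3"
        using s unfolding s_def[symmetric] by (simp add: power2_eq_square power3_eq_cube mult_ac)
      ultimately show ?thesis by simp
    qed
    moreover have "\<forall>\<^sub>F t in nhds q. (\<phi> has_real_derivative A / (R\<^sup>2 - t)\<^sup>2) (at t)"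
    proof -
      have "\<forall>\<^sub>F t in nhds q. t \<in> {..<R\<^sup>2}" using s by (intro eventually_nhds_in_open) (auto simp: s_def)
      then show ?thesis
      proof eventually_elim
        case (elim t)
        have "((\<lambda>t. R\<^sup>2 - t) has_real_derivative - 1) (at t)"
          by (rule derivative_eq_intros refl)+ simp
        from DERIV_add[OF DERIV_const[of 1] DERIV_divide[OF DERIV_const[of A] this]] elim
        show ?case by (simp add: \<phi>_def power2_eq_square)
      qed
    qed
    ultimately show ?thesis
      unfolding q_def n_def s_def by (intro has_laplacian_radial)
  qed
  from has_laplacian_diff[OF lap[of x] this]
  have "has_laplacian f (u x ^ 3 - u x - (4 * q * (2 * A / s ^ 3) + 2 * n * (A / s\<^sup>2))) x"
    by (simp add: f_def)
  from has_laplacian_max[OF this int x(2)]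
  have "u x ^ 3 - u x \<le> 4 * q * (2 * A / s ^ 3) + 2 * n * (A / s\<^sup>2)" by simp
  also have "\<dots> = A * (8 * q + 2 * n * s) / s ^ 3"
    using s by (simp add: field_simps power2_eq_square power3_eq_cube)
  \<comment> \<open>As \<open>q + s = R^2\<close>, the bracket is at most
    \<open>(8 + 2 n) R^2\<close>, the value chosen for \<open>A^2\<close>.\<close>
  also have "\<dots> \<le> A * A\<^sup>2 / s ^ 3"
  proof -
    have "n * s \<le> n * R\<^sup>2" using n s by (intro mult_left_mono) (auto simp: s_def)
    then have "8 * q + 2 * n * s \<le> A\<^sup>2" using s unfolding A(2) by (simp add: s_def algebra_simps)
    then show ?thesis using A(1) s by (intro divide_right_mono mult_left_mono) auto
  qed
  also have "\<dots> = (A / s) ^ 3" by (simp add: power_divide power3_eq_cube power2_eq_square)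
  finally have upper: "u x ^ 3 - u x \<le> (A / s) ^ 3" .
  \<comment> \<open>Expanding about \<open>1\<close> leaves only positive terms beyond
    \<open>v^3\<close>, and \<open>v\<close> exceeds \<open>A / s\<close> because
    \<open>f x > 0\<close>.\<close>
  define v where "v = u x - 1"
  have v: "0 < A / s" "A / s < v" using A s fx by (auto simp: v_def f_def \<phi>_def s_def q_def)
  then have "(A / s) ^ 3 < v ^ 3" by (intro power_strict_mono) auto
  moreover have "u x ^ 3 - u x = v ^ 3 + 3 * v\<^sup>2 + 2 * v"
    by (simp add: v_def power3_eq_cube power2_eq_square algebra_simps)
  ultimately show False
    using upper v zero_le_power2[of v] by linarith
qed

text \<open>The barrier vanishes on the sphere, and squaring gives it a positive Laplacian nearby,
  so it is a subsolution. On the closed ball \<open>u\<close> attains a positive minimum, as the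
  comparison requires. The resulting bound is independent of \<open>u\<close> and of the
  centre.\<close>

lemma allen_cahn_ball_lower_bound:
  fixes u :: "real ^ 'n::finite \<Rightarrow> real"
  defines "R \<equiv> real CARD('n) + 2"
  assumes "continuous_on UNIV u" and lap: "\<And>x. has_laplacian u (u x ^ 3 - u x) x"
    and pos: "\<And>y. y \<in> cball p R \<Longrightarrow> u y > 0" and "x \<in> cball p R"
  shows "(R\<^sup>2 - (norm (x - p))\<^sup>2)\<^sup>2 / (2 * R ^ 4) \<le> u x"
proof -
  have R: "R > 0" by (simp add: R_def)
  have cont: "continuous_on (cball p R) u" using assms(2) by (rule continuous_on_subset) simp
  from continuous_attains_inf[OF compact_cball _ this] R
  obtain m where m: "m \<in> cball p R" "\<And>y. y \<in> cball p R \<Longrightarrow> u m \<le> u y" by auto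
  define \<phi> where "\<phi> = (\<lambda>t. (R\<^sup>2 - t)\<^sup>2 / (2 * R ^ 4))"
  have q: "0 \<le> R\<^sup>2 - (norm (y - p))\<^sup>2" "R\<^sup>2 - (norm (y - p))\<^sup>2 \<le> R\<^sup>2" if "y \<in> cball p R" for y
  proof -
    have "(norm (y - p))\<^sup>2 \<le> R\<^sup>2"
      using that by (intro power_mono) (auto simp: dist_norm norm_minus_commute)
    then show "0 \<le> R\<^sup>2 - (norm (y - p))\<^sup>2" "R\<^sup>2 - (norm (y - p))\<^sup>2 \<le> R\<^sup>2" by auto
  qed
  have "\<phi> ((norm (x - p))\<^sup>2) \<le> u x"
  proof (rule allen_cahn_comparison[OF closed_cball _ cont, where \<delta> = "u m"])
    show "continuous_on (cball p R) (\<lambda>y. \<phi> ((norm (y - p))\<^sup>2))"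
      unfolding \<phi>_def using R by (intro continuous_intros) auto
    show "\<phi> ((norm (y - p))\<^sup>2) \<le> 1" if "y \<in> cball p R" for y
    proof -
      have "(R\<^sup>2 - (norm (y - p))\<^sup>2)\<^sup>2 \<le> (R\<^sup>2)\<^sup>2" using q[OF that] by (intro power_mono) auto
      then have "(R\<^sup>2 - (norm (y - p))\<^sup>2)\<^sup>2 \<le> R ^ 4" by simp
      moreover have "R ^ 4 > 0" using R by simp
      ultimately show ?thesis unfolding \<phi>_def by (subst divide_le_eq_1_pos) linarith+
    qed
    show "\<phi> ((norm (y - p))\<^sup>2) \<le> 0" if "y \<in> frontier (cball p R)" for y
      using that by (simp add: \<phi>_def dist_norm norm_minus_commute)
    show "u m > 0" using m(1) by (rule pos)
    show "u m \<le> u y" if "y \<in> cball p R" for y using that by (rule m(2))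
    show "\<exists>L. has_laplacian u L y \<and> L \<le> u y ^ 3 - u y" for y using lap by blast
    show "x \<in> cball p R" by fact
    show "\<exists>L. has_laplacian (\<lambda>y. \<phi> ((norm (y - p))\<^sup>2)) L y \<and>
        \<phi> ((norm (y - p))\<^sup>2) ^ 3 - \<phi> ((norm (y - p))\<^sup>2) \<le> L" if "y \<in> interior (cball p R)" for y
    proof (intro exI conjI)
      let ?q = "(norm (y - p))\<^sup>2"
      show "has_laplacian (\<lambda>y. \<phi> ((norm (y - p))\<^sup>2))
          (4 * ?q * (1 / R ^ 4) + 2 * real CARD('n) * (- (R\<^sup>2 - ?q) / R ^ 4)) y"
      proof (rule has_laplacian_radial)
        have deriv: "(\<phi> has_real_derivative - (R\<^sup>2 - t) / R ^ 4) (at t)" for t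
        proof -
          have "((\<lambda>t. (R\<^sup>2 - t)\<^sup>2) has_real_derivative - (2 * (R\<^sup>2 - t))) (at t)"
            by (rule derivative_eq_intros refl)+ simp
          moreover have "- (2 * (R\<^sup>2 - t)) / (2 * R ^ 4) = - (R\<^sup>2 - t) / R ^ 4"
            using R by (simp add: field_simps)
          ultimately show ?thesis
            unfolding \<phi>_def by (metis DERIV_cdivide)
        qed
        then show "\<forall>\<^sub>F t in nhds ?q. (\<phi> has_real_derivative - (R\<^sup>2 - t) / R ^ 4) (at t)"
          by simp
        show "((\<lambda>t. - (R\<^sup>2 - t) / R ^ 4) has_real_derivative 1 / R ^ 4) (at ?q)"
          by (rule DERIV_cdivide) (rule derivative_eq_intros refl | simp)+
      qed
      define s where "s = R\<^sup>2 - ?q"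
      have s: "0 \<le> s" "s \<le> R\<^sup>2" using q[of y] that interior_subset by (force simp: s_def)+
      \<comment> \<open>Since \<open>\<phi> \<le> 1 / 2\<close> on the ball, the cubic term is at
        most a quarter of \<open>\<phi>\<close>.\<close>
      have "\<phi> ?q ^ 3 \<le> s\<^sup>2 / (8 * R ^ 4)"
      proof -
        have "s ^ 4 \<le> (R\<^sup>2) ^ 4" using s by (intro power_mono) auto
        then have "s\<^sup>2 * s ^ 4 \<le> s\<^sup>2 * R ^ 8" by (intro mult_left_mono) auto
        then have "s ^ 6 / (8 * R ^ 12) \<le> s\<^sup>2 * R ^ 8 / (8 * R ^ 12)"
          using R by (intro divide_right_mono) (auto simp flip: power_add)
        moreover have "s\<^sup>2 * R ^ 8 / (8 * R ^ 12) = s\<^sup>2 / (8 * R ^ 4)"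
          using R by (simp add: field_simps flip: power_add)
        moreover have "\<phi> ?q ^ 3 = s ^ 6 / (8 * R ^ 12)"
          by (simp add: \<phi>_def s_def power_divide power_mult_distrib flip: power_mult)
        ultimately show ?thesis by simp
      qed
      then have "\<phi> ?q ^ 3 - \<phi> ?q \<le> s\<^sup>2 / (8 * R ^ 4) - s\<^sup>2 / (2 * R ^ 4)"
        by (simp add: \<phi>_def s_def)
      also have "\<dots> = (- 3 / 8 * s\<^sup>2) / R ^ 4" using R by (simp add: field_simps)
      also have "\<dots> \<le> (4 * ?q - 2 * real CARD('n) * s) / R ^ 4"
      proof -
        \<comment> \<open>The radius \<open>n + 2\<close> turns the linear term
          \<open>- (4 + 2 n) s\<close> into \<open>- 2 R s\<close>, which completes to a square with
          \<open>s^2 / 8\<close> to spare.\<close>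
        have "4 * ?q - 2 * real CARD('n) * s + 3 / 8 * s\<^sup>2 = (s - 4 * R)\<^sup>2 / 4 + s\<^sup>2 / 8"
          by (simp add: s_def R_def power2_eq_square field_simps)
        moreover have "0 \<le> (s - 4 * R)\<^sup>2 / 4 + s\<^sup>2 / 8" by simp
        ultimately have "- 3 / 8 * s\<^sup>2 \<le> 4 * ?q - 2 * real CARD('n) * s" by linarith
        then show ?thesis using R by (intro divide_right_mono) auto
      qed
      also have "\<dots> = 4 * ?q * (1 / R ^ 4) + 2 * real CARD('n) * (- (R\<^sup>2 - ?q) / R ^ 4)"
        using R by (simp add: s_def field_simps)
      finally show "\<phi> ?q ^ 3 - \<phi> ?q \<le> 4 * ?q * (1 / R ^ 4) + 2 * real CARD('n) * (- (R\<^sup>2 - ?q) / R ^ 4)" .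
    qed
  qed
  then show ?thesis by (simp add: \<phi>_def)
qed

section \<open>The one-dimensional profile\<close>

lemma H_bounds: "H t < 1" "- 1 < H t"
  using tanh_real_bounds[of "t / sqrt 2"] by (auto simp: H_def)

lemma H_zero [simp]: "H 0 = 0"
  by (simp add: H_def)

lemma H_minus: "H (- t) = - H t"
  by (simp add: H_def)

lemma H_mono: "s \<le> t \<Longrightarrow> H s \<le> H t"
  by (simp add: H_def divide_right_mono)

lemma H_pos: "t > 0 \<Longrightarrow> H t > 0"
  by (simp add: H_def)

lemma H_has_real_derivative: "(H has_real_derivative (1 - (H t)\<^sup>2) / sqrt 2) (at t)"
proof -
  have "((\<lambda>t. t / sqrt 2) has_real_derivative 1 / sqrt 2) (at t)"
    by (rule DERIV_cdivide[OF DERIV_ident])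
  from has_field_derivative_tanh[OF _ this] show ?thesis
    by (simp add: H_def[abs_def])
qed

lemma continuous_on_H: "continuous_on S H"
  by (rule DERIV_continuous_on[where D = "\<lambda>t. (1 - (H t)\<^sup>2) / sqrt 2"])
     (rule has_field_derivative_at_within[OF H_has_real_derivative])

text \<open>From \<open>H' = (1 - H^2) / sqrt 2\<close> follows \<open>H'' = H^3 - H\<close>, so
  planar profiles solve the equation exactly and can serve as sub- and as supersolutions.\<close>

lemma has_laplacian_H:
  fixes e :: "real ^ 'n::finite"
  assumes "norm e = 1"
  shows "has_laplacian (\<lambda>y. H (y \<bullet> e + a)) (H (x \<bullet> e + a) ^ 3 - H (x \<bullet> e + a)) x"
proof (rule has_laplacian_planar[OF H_has_real_derivative _ assms])
  let ?D = "\<lambda>t. (1 - (H t)\<^sup>2) / sqrt 2"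
  have "(?D has_real_derivative (0 - 2 * H t * ?D t) / sqrt 2) (at t)" for t
    using DERIV_cdivide[OF DERIV_diff[OF DERIV_const DERIV_power[OF H_has_real_derivative]], of 1 2 "sqrt 2" t]
    by (simp add: mult_ac)
  moreover have "(0 - 2 * H t * ?D t) / sqrt 2 = H t ^ 3 - H t" for t
    by (simp add: power2_eq_square power3_eq_cube algebra_simps diff_divide_distrib)
  ultimately show "(?D has_real_derivative H t ^ 3 - H t) (at t)" for t
    by simp
qed

section \<open>Bounds in a half-space\<close>

text \<open>The comparison asks for a supersolution with a positive lower bound, but the profile
  vanishes on the boundary. Shifting it by \<open>t > 0\<close> supplies the bound
  \<open>H t\<close>, and then \<open>t\<close> tends to \<open>0\<close>.\<close>

lemma allen_cahn_halfspace_upper_bound: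
  fixes u :: "real ^ 'n::finite \<Rightarrow> real"
  assumes "continuous_on UNIV u" and lap: "\<And>x. has_laplacian u (u x ^ 3 - u x) x"
    and "norm e = 1" and boundary: "\<And>x. x \<bullet> e = b \<Longrightarrow> u x \<le> 0" and z: "b \<le> z \<bullet> e"
  shows "u z \<le> H (z \<bullet> e - b)"
proof -
  define S where "S = {x. e \<bullet> x \<ge> b}"
  have "e \<noteq> 0" using assms(3) by auto
  have shifted: "u z \<le> H (z \<bullet> e + (t - b))" if "t > 0" for t
  proof (rule allen_cahn_comparison[where S = S and \<delta> = "H t" and f = u and z = z
        and g = "\<lambda>x. H (x \<bullet> e + (t - b))"])
    show "closed S" unfolding S_def by (rule closed_halfspace_ge)
    show "continuous_on S u" using assms(1) by (rule continuous_on_subset) simp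
    show "continuous_on S (\<lambda>x. H (x \<bullet> e + (t - b)))"
      by (intro continuous_on_compose2[OF continuous_on_H[of UNIV]] continuous_intros) auto
    show "u x \<le> 1" for x using assms(1) lap by (rule allen_cahn_le_one)
    show "u x \<le> 0" if "x \<in> frontier S" for x
    proof (rule boundary)
      have "e \<bullet> x = b" using that \<open>e \<noteq> 0\<close> by (simp add: S_def frontier_halfspace_ge)
      then show "x \<bullet> e = b" by (simp add: inner_commute)
    qed
    show "0 < H t" using that by (rule H_pos)
    show "H t \<le> H (x \<bullet> e + (t - b))" if "x \<in> S" for x
      using that by (intro H_mono) (simp add: S_def inner_commute)
    show "\<exists>L. has_laplacian u L x \<and> u x ^ 3 - u x \<le> L" for x using lap by blast
    show "\<exists>L. has_laplacian (\<lambda>x. H (x \<bullet> e + (t - b))) L x \<and>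
            L \<le> H (x \<bullet> e + (t - b)) ^ 3 - H (x \<bullet> e + (t - b))" for x
      using has_laplacian_H[OF assms(3)] by blast
    show "z \<in> S" using z by (simp add: S_def inner_commute)
  qed
  have "((\<lambda>t. H (z \<bullet> e + (t - b))) \<longlongrightarrow> H (z \<bullet> e + (0 - b))) (at_right 0)"
    by (intro continuous_on_tendsto_compose[OF continuous_on_H[of UNIV]] tendsto_intros) auto
  moreover have "\<forall>\<^sub>F t in at_right 0. u z \<le> H (z \<bullet> e + (t - b))"
    using eventually_at_right_less[of 0] by eventually_elim (rule shifted)
  ultimately have "u z \<le> H (z \<bullet> e + (0 - b))"
    by (rule tendsto_lowerbound) simp
  then show ?thesis by simp
qed

text \<open>Here \<open>u\<close> is the supersolution, and its positive lower bound on an unbounded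
  set comes from balls of one fixed radius inside the region where \<open>u > 0\<close>.\<close>

lemma allen_cahn_halfspace_lower_bound:
  fixes u :: "real ^ 'n::finite \<Rightarrow> real"
  assumes "continuous_on UNIV u" and lap: "\<And>x. has_laplacian u (u x ^ 3 - u x) x"
    and "norm e = 1" and pos: "\<And>x. x \<bullet> e > b \<Longrightarrow> u x > 0" and z: "b < z \<bullet> e"
  shows "H (z \<bullet> e - b) \<le> u z"
proof -
  define R where "R = real CARD('n) + 2"
  have "R > 2" by (simp add: R_def)
  have "e \<noteq> 0" and ee: "e \<bullet> e = 1" using assms(3) by (auto simp: dot_square_norm)
  have shifted: "H (z \<bullet> e + (- b - t)) \<le> u z" if t: "0 < t" "t < 1" "t \<le> z \<bullet> e - b" for t
  proof -
    define S where "S = {x. e \<bullet> x \<ge> b + t}"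
    \<comment> \<open>This is the value of the ball barrier at distance \<open>R - t / 2\<close>
      from the centre.\<close>
    define \<delta> where "\<delta> = (R\<^sup>2 - (R - t / 2)\<^sup>2)\<^sup>2 / (2 * R ^ 4)"
    show ?thesis
    proof (rule allen_cahn_comparison[where S = S and \<delta> = \<delta> and g = u and z = z
          and f = "\<lambda>x. H (x \<bullet> e + (- b - t))"])
      show "closed S" unfolding S_def by (rule closed_halfspace_ge)
      show "continuous_on S u" using assms(1) by (rule continuous_on_subset) simp
      show "continuous_on S (\<lambda>x. H (x \<bullet> e + (- b - t)))"
        by (intro continuous_on_compose2[OF continuous_on_H[of UNIV]] continuous_intros) auto
      show "H (x \<bullet> e + (- b - t)) \<le> 1" for x using H_bounds(1) by (rule less_imp_le)
      show "H (x \<bullet> e + (- b - t)) \<le> 0" if "x \<in> frontier S" for x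
      proof -
        have "e \<bullet> x = b + t" using that \<open>e \<noteq> 0\<close> by (simp add: S_def frontier_halfspace_ge)
        then show ?thesis by (simp add: inner_commute[of x])
      qed
      show "\<delta> > 0"
      proof -
        have "(R - t / 2)\<^sup>2 < R\<^sup>2" using t \<open>R > 2\<close> by (intro power_strict_mono) auto
        then show ?thesis using \<open>R > 2\<close> by (simp add: \<delta>_def)
      qed
      show "\<delta> \<le> u x" if "x \<in> S" for x
      proof -
        \<comment> \<open>The ball around \<open>p\<close> stays at height at least
          \<open>b + t / 2\<close>, where \<open>u > 0\<close>, while \<open>x\<close> lies
          \<open>t / 2\<close> inside its sphere.\<close>
        define p where "p = x + (R - t / 2) *\<^sub>R e"
        have dist: "norm (x - p) = R - t / 2" using t \<open>R > 2\<close> assms(3) by (simp add: p_def)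
        have "u y > 0" if "y \<in> cball p R" for y
        proof (rule pos)
          have "(p - y) \<bullet> e \<le> norm (p - y) * norm e" by (rule norm_cauchy_schwarz)
          also have "\<dots> \<le> R" using that assms(3) by (simp add: dist_norm)
          finally have "p \<bullet> e - R \<le> y \<bullet> e" by (simp add: inner_diff_left)
          moreover have "p \<bullet> e = x \<bullet> e + (R - t / 2)" by (simp add: p_def inner_left_distrib ee)
          ultimately show "b < y \<bullet> e" using \<open>x \<in> S\<close> t by (simp add: S_def inner_commute)
        qed
        moreover have "x \<in> cball p R" using dist t by (simp add: dist_norm norm_minus_commute)
        ultimately have "(R\<^sup>2 - (norm (x - p))\<^sup>2)\<^sup>2 / (2 * R ^ 4) \<le> u x"
          unfolding R_def by (intro allen_cahn_ball_lower_bound assms(1) lap)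
        then show ?thesis by (simp add: \<delta>_def dist)
      qed
      show "\<exists>L. has_laplacian (\<lambda>x. H (x \<bullet> e + (- b - t))) L x \<and>
              H (x \<bullet> e + (- b - t)) ^ 3 - H (x \<bullet> e + (- b - t)) \<le> L" for x
        using has_laplacian_H[OF assms(3)] by blast
      show "\<exists>L. has_laplacian u L x \<and> L \<le> u x ^ 3 - u x" for x using lap by blast
      show "z \<in> S" using t by (simp add: S_def inner_commute)
    qed
  qed
  have "((\<lambda>t. H (z \<bullet> e + (- b - t))) \<longlongrightarrow> H (z \<bullet> e + (- b - 0))) (at_right 0)"
    by (intro continuous_on_tendsto_compose[OF continuous_on_H[of UNIV]] tendsto_intros) auto
  moreover have "\<forall>\<^sub>F t in at_right 0. H (z \<bullet> e + (- b - t)) \<le> u z"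
  proof -
    have "\<forall>\<^sub>F t in at_right 0. t \<in> {0<..<min 1 (z \<bullet> e - b)}"
      using z by (intro eventually_at_right_real) simp
    then show ?thesis by eventually_elim (rule shifted, auto)
  qed
  ultimately have "H (z \<bullet> e + (- b - 0)) \<le> u z"
    by (rule tendsto_upperbound) simp
  then show ?thesis by simp
qed

section \<open>The strong maximum principle\<close>

text \<open>If \<open>w p > 0\<close>, the Gaussian barrier \<open>m (exp (- \<alpha> |x - p|\<^sup>2) - exp (- \<alpha> R\<^sup>2))\<close> lies below \<open>w\<close> on
  arbitrarily large annuli around \<open>p\<close>, so \<open>w\<close> vanishes nowhere.\<close>

lemma strong_maximum_principle:
  fixes w :: "real ^ 'n::finite \<Rightarrow> real"
  assumes "continuous_on UNIV w" and nonneg: "\<And>x. w x \<ge> 0" and "C \<ge> 0"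
    and super: "\<And>x. \<exists>L. has_laplacian w L x \<and> L \<le> C * w x"
    and "w z = 0"
  shows "w p = 0"
proof (rule ccontr)
  assume "w p \<noteq> 0"
  with nonneg[of p] have wp: "w p > 0" by simp
  define m where "m = w p / 2"
  have m: "m > 0" "m < w p" using wp by (auto simp: m_def)
  define n where "n = real CARD('n)"
  have "n > 0" by (simp add: n_def)
  have "open {x. m < w x}" using assms(1) by (intro open_Collect_less) auto
  moreover have "p \<in> {x. m < w x}" using m by simp
  ultimately obtain d where d: "d > 0" "ball p d \<subseteq> {x. m < w x}"
    unfolding open_contains_ball by blast
  define r where "r = min (d / 2) 1"
  have r: "0 < r" "r < d" "r \<le> 1" using d(1) by (auto simp: r_def min_def)
  have near: "m < w y" if "norm (y - p) \<le> r" for y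
    using d(2) that r(2) by (force simp: dist_norm norm_minus_commute)
  \<comment> \<open>The extra \<open>1\<close> puts \<open>z\<close> strictly inside the outer
    sphere, so the barrier is positive at this zero of \<open>w\<close>.\<close>
  define R where "R = norm (z - p) + 1"
  have "r < norm (z - p)" using near[of z] \<open>w z = 0\<close> m(1) by force
  then have R: "r < R" "norm (z - p) < R" using r(1) by (auto simp: R_def)
  \<comment> \<open>Where \<open>|x - p| \<ge> r\<close>, the barrier then has Laplacian at least
    \<open>2 \<alpha> (C + 1) g\<close> for its Gaussian term \<open>g\<close>. This exceeds
    \<open>C g\<close>, as \<open>r \<le> 1\<close> forces
    \<open>2 \<alpha> \<ge> 1\<close>.\<close>
  define \<alpha> where "\<alpha> = (n + C + 1) / (2 * r\<^sup>2)"
  have \<alpha>: "\<alpha> > 0" "2 * \<alpha> * r\<^sup>2 = n + C + 1" "1 / 2 \<le> \<alpha>"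
  proof -
    show "\<alpha> > 0" "2 * \<alpha> * r\<^sup>2 = n + C + 1" using r(1) \<open>n > 0\<close> assms(3) by (auto simp: \<alpha>_def)
    moreover have "r\<^sup>2 \<le> 1" using r by (simp add: power_le_one)
    ultimately have "2 * \<alpha> * r\<^sup>2 \<le> 2 * \<alpha> * 1" by (intro mult_left_mono) auto
    then show "1 / 2 \<le> \<alpha>" using \<open>2 * \<alpha> * r\<^sup>2 = n + C + 1\<close> \<open>n > 0\<close> assms(3) by linarith
  qed
  define \<phi> where "\<phi> = (\<lambda>t. m * (exp (- \<alpha> * t) - exp (- \<alpha> * R\<^sup>2)))"
  define f where "f = (\<lambda>y. \<phi> ((norm (y - p))\<^sup>2) - w y)"
  define K where "K = cball p R - ball p r"
  have K_iff: "y \<in> K \<longleftrightarrow> r \<le> norm (y - p) \<and> norm (y - p) \<le> R" for y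
    by (auto simp: K_def dist_norm norm_minus_commute)
  have "compact K" unfolding K_def by (intro compact_diff) auto
  moreover have "z \<in> K" using R \<open>r < norm (z - p)\<close> by (simp add: K_iff)
  moreover have "continuous_on K f"
    unfolding f_def \<phi>_def by (intro continuous_intros continuous_on_subset[OF assms(1)]) auto
  ultimately obtain x where x: "x \<in> K" "\<And>y. y \<in> K \<Longrightarrow> f y \<le> f x"
    using continuous_attains_sup[of K f] by blast
  have "f z > 0"
  proof -
    have "(norm (z - p))\<^sup>2 < R\<^sup>2" using R(2) by (intro power_strict_mono) auto
    then show ?thesis using m(1) \<alpha>(1) \<open>w z = 0\<close> by (simp add: f_def \<phi>_def)
  qed
  with x(2)[OF \<open>z \<in> K\<close>] have fx: "f x > 0" by simp
  define q where "q = (norm (x - p))\<^sup>2"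
  \<comment> \<open>On the outer sphere the barrier is \<open>0 \<le> w\<close>, on the inner one it
    is at most \<open>m < w\<close>, so the positive maximum of \<open>f\<close> lies in
    between.\<close>
  have "norm (x - p) \<noteq> R" using fx nonneg[of x] by (auto simp: f_def \<phi>_def)
  moreover have "norm (x - p) \<noteq> r"
  proof
    assume "norm (x - p) = r"
    then have "m < w x" by (intro near) simp
    moreover have "\<phi> q \<le> m * 1"
      unfolding \<phi>_def using m(1) \<alpha>(1) by (intro mult_left_mono) (auto simp: q_def intro: order_trans[of _ "exp (- \<alpha> * q)"])
    ultimately show False using fx by (simp add: f_def q_def)
  qed
  ultimately have "x \<in> ball p R - cball p r"
    using x(1) by (auto simp: K_iff dist_norm norm_minus_commute)
  moreover have "ball p R - cball p r \<subseteq> interior K"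
    by (intro interior_maximal) (auto simp: K_def)
  ultimately have int: "x \<in> interior K" by blast
  define g where "g = m * exp (- \<alpha> * q)"
  have "g > 0" using m(1) by (simp add: g_def)
  have barrier: "has_laplacian (\<lambda>y. \<phi> ((norm (y - p))\<^sup>2)) (4 * q * (\<alpha>\<^sup>2 * g) + 2 * n * (- \<alpha> * g)) x"
  proof -
    have exp: "((\<lambda>t. exp (- \<alpha> * t)) has_real_derivative - \<alpha> * exp (- \<alpha> * t)) (at t)" for t
      by (rule derivative_eq_intros refl)+ simp
    have "(\<phi> has_real_derivative - \<alpha> * (m * exp (- \<alpha> * t))) (at t)" for t
      using DERIV_cmult[OF DERIV_diff[OF exp DERIV_const], of m "exp (- \<alpha> * R\<^sup>2)" t]
      unfolding \<phi>_def by (simp add: mult_ac)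
    then have "\<forall>\<^sub>F t in nhds q. (\<phi> has_real_derivative - \<alpha> * (m * exp (- \<alpha> * t))) (at t)" by simp
    moreover have "((\<lambda>t. - \<alpha> * (m * exp (- \<alpha> * t))) has_real_derivative \<alpha>\<^sup>2 * g) (at q)"
      using DERIV_cmult[OF DERIV_cmult[OF exp], of "- \<alpha>" m q]
      by (simp add: g_def power2_eq_square mult_ac)
    ultimately show ?thesis
      unfolding q_def n_def g_def by (rule has_laplacian_radial)
  qed
  from super[of x] obtain L where L: "has_laplacian w L x" "L \<le> C * w x" by blast
  from has_laplacian_diff[OF barrier L(1)]
  have "has_laplacian f (4 * q * (\<alpha>\<^sup>2 * g) + 2 * n * (- \<alpha> * g) - L) x" by (simp add: f_def)
  from has_laplacian_max[OF this int x(2)]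
  have "4 * q * (\<alpha>\<^sup>2 * g) + 2 * n * (- \<alpha> * g) \<le> L" by simp
  also have "L \<le> C * w x" by (rule L(2))
  \<comment> \<open>A positive value of \<open>f\<close> puts \<open>w x\<close> below the barrier,
    hence below \<open>g\<close>.\<close>
  also have "\<dots> \<le> C * g"
  proof (rule mult_left_mono[OF _ assms(3)])
    have "\<phi> q \<le> g" using m(1) by (simp add: \<phi>_def g_def)
    then show "w x \<le> g" using fx by (simp add: f_def q_def)
  qed
  finally have "(4 * q * \<alpha>\<^sup>2 - 2 * n * \<alpha>) * g \<le> C * g" by (simp add: algebra_simps)
  then have "4 * q * \<alpha>\<^sup>2 - 2 * n * \<alpha> \<le> C" using \<open>g > 0\<close> by simp
  moreover have "2 * \<alpha> * (n + C + 1) \<le> 4 * q * \<alpha>\<^sup>2"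
  proof -
    have "r\<^sup>2 \<le> q" unfolding q_def using x(1) r(1) by (intro power_mono) (auto simp: K_iff)
    then have "4 * \<alpha>\<^sup>2 * r\<^sup>2 \<le> 4 * \<alpha>\<^sup>2 * q" by (intro mult_left_mono) auto
    moreover have "2 * \<alpha> * (n + C + 1) = 4 * \<alpha>\<^sup>2 * r\<^sup>2"
      unfolding \<alpha>(2)[symmetric] by (simp add: power2_eq_square)
    ultimately show ?thesis by (simp add: mult_ac)
  qed
  moreover have "1 * (C + 1) \<le> 2 * \<alpha> * (C + 1)" using \<alpha>(3) assms(3) by (intro mult_right_mono) auto
  ultimately show False using assms(3) by (simp add: algebra_simps)
qed

section \<open>Rigidity and the conclusion\<close>

text \<open>This is the case of positive sign; the other sign reduces to it by passing to
  \<open>- u\<close>.\<close>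

lemma allen_cahn_halfspace_rigidity:
  fixes u :: "real ^ 'n::finite \<Rightarrow> real"
  assumes cont: "continuous_on UNIV u" and lap: "\<And>x. has_laplacian u (u x ^ 3 - u x) x"
    and e: "norm e = 1" and pos: "\<And>x. x \<bullet> e > b \<Longrightarrow> u x > 0"
    and x0: "x0 \<bullet> e = b" "u x0 = 0"
  shows "u x = H (x \<bullet> e - b)"
proof -
  have cont': "continuous_on UNIV (\<lambda>x. - u x)" using cont by (intro continuous_intros)
  have lap': "has_laplacian (\<lambda>x. - u x) ((- u x) ^ 3 - (- u x)) x" for x
    using has_laplacian_minus[OF lap[of x]] by simp
  \<comment> \<open>Positivity is assumed only in the open half-space; approaching the boundary
    along \<open>e\<close> gives \<open>u \<ge> 0\<close> there by continuity.\<close>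
  have boundary: "- u y \<le> 0" if "y \<bullet> (- e) = - b" for y
  proof -
    have "((\<lambda>t. u (y + t *\<^sub>R e)) \<longlongrightarrow> u (y + 0 *\<^sub>R e)) (at_right 0)"
      by (intro continuous_on_tendsto_compose[OF cont] tendsto_intros) auto
    moreover have "\<forall>\<^sub>F t in at_right 0. 0 \<le> u (y + t *\<^sub>R e)"
      using eventually_at_right_less[of 0]
    proof eventually_elim
      case (elim t)
      have "(y + t *\<^sub>R e) \<bullet> e = b + t" using that e by (simp add: inner_left_distrib dot_square_norm)
      then show ?case using elim pos[of "y + t *\<^sub>R e"] by simp
    qed
    ultimately have "0 \<le> u (y + 0 *\<^sub>R e)" by (rule tendsto_lowerbound) simp
    then show ?thesis by simp
  qed
  have ge: "H (y \<bullet> e - b) \<le> u y" for y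
  proof (cases "b < y \<bullet> e")
    case True
    with cont lap e pos show ?thesis by (intro allen_cahn_halfspace_lower_bound)
  next
    case False
    \<comment> \<open>The opposite half-space has normal \<open>- e\<close> and level
      \<open>- b\<close>; oddness of \<open>H\<close> turns the upper bound for \<open>- u\<close>
      into the same lower bound for \<open>u\<close>.\<close>
    then have "- u y \<le> H (y \<bullet> (- e) - (- b))"
      using e by (intro allen_cahn_halfspace_upper_bound[OF cont' lap' _ boundary]) auto
    then show ?thesis using H_minus[of "y \<bullet> e - b"] by simp
  qed
  define h where "h = (\<lambda>y. H (y \<bullet> e + (- b)))"
  have "u x - h x = 0"
  proof (rule strong_maximum_principle[where C = 2 and z = x0])
    show "continuous_on UNIV (\<lambda>y. u y - h y)"
      unfolding h_def
      by (intro continuous_on_compose2[OF continuous_on_H[of UNIV]] continuous_intros cont) auto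
    show nonneg: "0 \<le> u y - h y" for y using ge[of y] by (simp add: h_def)
    show "u x0 - h x0 = 0" using x0 by (simp add: h_def)
    show "\<exists>L. has_laplacian (\<lambda>y. u y - h y) L y \<and> L \<le> 2 * (u y - h y)" for y
    proof (intro exI conjI)
      show "has_laplacian (\<lambda>y. u y - h y) (u y ^ 3 - u y - (h y ^ 3 - h y)) y"
        unfolding h_def by (intro has_laplacian_diff lap has_laplacian_H e)
      have "u y \<le> 1" "- u y \<le> 1" by (rule allen_cahn_le_one[OF cont lap] allen_cahn_le_one[OF cont' lap'])+
      then have u: "\<bar>u y\<bar> \<le> 1" by simp
      have h: "\<bar>h y\<bar> \<le> 1" using H_bounds[of "y \<bullet> e + (- b)"] by (simp add: h_def)
      \<comment> \<open>The difference of the two nonlinearities is \<open>u - h\<close> times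
        \<open>u^2 + u h + h^2 - 1\<close>. Each of the three products is at most \<open>1\<close>,
        whence the constant \<open>2\<close>.\<close>
      have "\<bar>u y * h y\<bar> \<le> 1" using u h unfolding abs_mult by (intro mult_le_one) auto
      moreover have "(u y)\<^sup>2 \<le> 1" "(h y)\<^sup>2 \<le> 1" using u h by (simp_all add: abs_square_le_1)
      ultimately have "(u y)\<^sup>2 + u y * h y + (h y)\<^sup>2 - 1 \<le> 2" by simp
      from mult_right_mono[OF this nonneg[of y]]
      show "u y ^ 3 - u y - (h y ^ 3 - h y) \<le> 2 * (u y - h y)"
        by (simp add: power2_eq_square power3_eq_cube algebra_simps)
    qed
  qed simp
  then show ?thesis by (simp add: h_def)
qed

theorem corollary5:
  fixes u :: "real ^ 'n::finite \<Rightarrow> real" and E :: "(real ^ 'n) set"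
  assumes "classical_allen_cahn_solution u"
    and "\<not> u constant_on UNIV"
    and "is_closed_halfspace E"
    and "{x. u x = 0} \<subseteq> E"
    and "{x. u x = 0} \<inter> frontier E \<noteq> {}"
  shows "\<exists>(a::real) (e::real ^ 'n). norm e = 1 \<and> orthogonal_to_affine e (frontier E) \<and>
           (\<forall>x. u x = H (x \<bullet> e + a))"
proof -
  have C2: "C2 u" and eq: "laplacian u x = u x ^ 3 - u x" for x
    using assms(1) by (auto simp: classical_allen_cahn_solution_def algebra_simps)
  have lap: "has_laplacian u (u x ^ 3 - u x) x" for x
    using C2_has_laplacian[OF C2, of x] by (simp add: eq)
  have cont: "continuous_on UNIV u"
    using C2 unfolding C2_def C1_def
    by (intro differentiable_imp_continuous_on) (auto simp: differentiable_on_def differentiable_at_withinI)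
  obtain v b' where v: "v \<noteq> 0" "E = {x. v \<bullet> x \<le> b'}"
    using assms(3) unfolding is_closed_halfspace_def by blast
  define e where "e = v /\<^sub>R norm v"
  define b where "b = b' / norm v"
  have e: "norm e = 1" using v(1) by (simp add: e_def)
  have inner: "x \<bullet> e = (v \<bullet> x) / norm v" for x
    by (simp add: e_def inner_commute divide_inverse mult.commute)
  have E: "x \<in> E \<longleftrightarrow> x \<bullet> e \<le> b" for x
    using v(1) by (simp add: v(2) inner b_def divide_le_cancel)
  have frontier: "x \<in> frontier E \<longleftrightarrow> x \<bullet> e = b" for x
    using v(1) by (simp add: v(2) inner b_def frontier_halfspace_le)
  have orth: "orthogonal_to_affine e (frontier E)" "orthogonal_to_affine (- e) (frontier E)"
    by (auto simp: orthogonal_to_affine_def frontier orthogonal_def inner_diff_right inner_commute[of e])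
  obtain x0 where x0: "u x0 = 0" "x0 \<bullet> e = b"
    using assms(5) frontier by blast
  define D where "D = {x. e \<bullet> x > b}"
  have D: "x \<in> D \<longleftrightarrow> x \<bullet> e > b" for x by (simp add: D_def inner_commute)
  have nonzero: "u x \<noteq> 0" if "x \<in> D" for x using assms(4) that E[of x] D[of x] by auto
  have conn: "connected (u ` D)"
    unfolding D_def
    by (intro connected_continuous_image continuous_on_subset[OF cont] convex_connected
          convex_halfspace_gt) simp
  \<comment> \<open>\<open>D\<close> is the complement of \<open>E\<close>, where \<open>u\<close>
    has no zero; its image being connected, a change of sign would produce one.\<close>
  have "(\<forall>x\<in>D. u x > 0) \<or> (\<forall>x\<in>D. u x < 0)"
  proof (rule ccontr)
    assume "\<not> ?thesis"
    then obtain x y where xy: "x \<in> D" "u x \<le> 0" "y \<in> D" "0 \<le> u y" by (auto simp: not_less)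
    then have "{u x..u y} \<subseteq> u ` D" by (intro connected_contains_Icc[OF conn] imageI)
    then have "0 \<in> u ` D" using xy by auto
    then show False using nonzero by force
  qed
  then show ?thesis
  proof
    assume "\<forall>x\<in>D. u x > 0"
    then have "u x = H (x \<bullet> e + (- b))" for x
      using allen_cahn_halfspace_rigidity[OF cont lap e _ x0(2,1)] by (simp add: D)
    with e orth(1) show ?thesis by blast
  next
    assume neg: "\<forall>x\<in>D. u x < 0"
    have cont': "continuous_on UNIV (\<lambda>x. - u x)" using cont by (intro continuous_intros)
    have lap': "has_laplacian (\<lambda>x. - u x) ((- u x) ^ 3 - (- u x)) x" for x
      using has_laplacian_minus[OF lap[of x]] by simp
    have "- u x = H (x \<bullet> e - b)" for x
      using neg x0 by (intro allen_cahn_halfspace_rigidity[OF cont' lap' e]) (auto simp: D)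
    \<comment> \<open>Oddness of \<open>H\<close> moves the sign of \<open>u\<close> into the
      direction, so the unit vector is now \<open>- e\<close>.\<close>
    then have "u x = H (x \<bullet> (- e) + b)" for x
      using H_minus[of "x \<bullet> e - b"] by (metis add.commute diff_minus_eq_add inner_minus_right
          minus_diff_eq minus_minus uminus_add_conv_diff)
    with e orth(2) show ?thesis by (metis norm_minus_cancel)
  qed
qed

end
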